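(* Let $n\ge 5$, let $B$ be a $3$-by-$3$ reciprocal matrix, and let $$A=\begin{bmatrix} B & J_{3,n-3}\\ J_{n-3,3} & J_{n-3}\end{bmatrix}.$$ Then $$\mathcal{E}(A)=\bigcup_{i=4}^{n}\mathcal{E}(A;i).$$
   Context: An $n$-by-$n$ entrywise positive matrix $A=[a_{ij}]$ is reciprocal if $a_{ji}=1/a_{ij}$ for all $i,j$. $J_{m,k}$ denotes the $m$-by-$k$ all-ones matrix, $J_m=J_{m,m}$. A vector $w$ with positive entries is efficient for a reciprocal matrix $A$ if, for every positive vector $v$, the entrywise inequality $\left|A-[v_i/v_j]\right|\le\left|A-[w_i/w_j]\right|$ implies $v=w$; $\mathcal{E}(A)$ denotes the set of efficient vectors for $A$. For $i\in\{1,\ldots,n\}$, $A(i)$ is the principal submatrix obtained by deleting row and column $i$, $w(i)$ is the vector obtained by deleting entry $i$, and $\mathcal{E}(A;i)=\{w\in\mathcal{E}(A): w(i)\in\mathcal{E}(A(i))\}$.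
   Formalization: Efficiency is taken up to positive scaling: the inequality must imply v = c·w for some c > 0, since with literal v = w the vector v = 2w shows that no vector would be efficient. *)

theory Defs
  imports Jordan_Normal_Form.Determinant
begin

definition reciprocal_mat :: "real mat \<Rightarrow> bool" where
  "reciprocal_mat A \<longleftrightarrow> square_mat A \<and>
     (\<forall>i < dim_row A. \<forall>j < dim_row A. 0 < A $$ (i, j) \<and> A $$ (j, i) = 1 / A $$ (i, j))"

definition ones_mat :: "nat \<Rightarrow> nat \<Rightarrow> real mat" where
  "ones_mat m k = mat m k (\<lambda>_. 1)"

definition positive_vec :: "real vec \<Rightarrow> bool" where
  "positive_vec w \<longleftrightarrow> (\<forall>i < dim_vec w. 0 < w $ i)"

definition vec_delete :: "'a vec \<Rightarrow> nat \<Rightarrow> 'a vec" where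
  "vec_delete w i = vec (dim_vec w - 1) (\<lambda>k. w $ (if k < i then k else Suc k))"

text \<open>The matrix of ratios of \<open>v\<close> does not change when \<open>v\<close> is scaled, so uniqueness of an efficient
  vector is meant up to a positive factor (literal equality would make no vector efficient).\<close>

definition efficient :: "real mat \<Rightarrow> real vec \<Rightarrow> bool" where
  "efficient A w \<longleftrightarrow> w \<in> carrier_vec (dim_row A) \<and> positive_vec w \<and>
     (\<forall>v \<in> carrier_vec (dim_row A). positive_vec v \<longrightarrow>
        (\<forall>i < dim_row A. \<forall>j < dim_row A.
           \<bar>A $$ (i, j) - v $ i / v $ j\<bar> \<le> \<bar>A $$ (i, j) - w $ i / w $ j\<bar>) \<longrightarrow>
        (\<exists>c > 0. v = c \<cdot>\<^sub>v w))"

definition efficient_vecs :: "real mat \<Rightarrow> real vec set" where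
  "efficient_vecs A = {w. efficient A w}"

definition efficient_vecs_at :: "real mat \<Rightarrow> nat \<Rightarrow> real vec set" where
  "efficient_vecs_at A i =
     {w \<in> efficient_vecs A. vec_delete w i \<in> efficient_vecs (mat_delete A i i)}"

end

theory Submission
  imports Defs
begin

text \<open>
  Draw an arc from \<open>i\<close> to \<open>j\<close> when \<open>w\<^sub>i / w\<^sub>j \<ge> a\<^sub>i\<^sub>j\<close>. A vector \<open>w\<close> is efficient iff this digraph is strongly
  connected, i.e. every nonempty proper vertex set has an outgoing arc: if \<open>S\<close> has none, scaling \<open>w\<close> up
  on \<open>S\<close> improves the approximation; conversely, if \<open>v\<close> is at least as good as \<open>w\<close>, an arc leaving the
  set where \<open>v\<^sub>i / w\<^sub>i\<close> is maximal would be approximated worse by \<open>v\<close>.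

  For the block matrix, arcs outside the \<open>3\<times>3\<close> block just compare entries of \<open>w\<close>. Among the indices
  outside the block let \<open>t\<close> and \<open>b\<close> carry the largest and smallest entry. If there are at least three
  such indices, any one other than \<open>t\<close> and \<open>b\<close> can be deleted keeping strong connectivity; if there
  are only two, then \<open>t\<close> or \<open>b\<close> can.
\<close>

section \<open>Strong connectivity through cuts, and how a vertex deletion destroys it\<close>

definition cut_connected :: "'a set \<Rightarrow> ('a \<Rightarrow> 'a \<Rightarrow> bool) \<Rightarrow> bool" where
  "cut_connected V E \<longleftrightarrow> (\<forall>S. S \<subset> V \<longrightarrow> S \<noteq> {} \<longrightarrow> (\<exists>i\<in>S. \<exists>j\<in>V - S. E i j))"

lemma cut_connectedD:
  assumes "cut_connected V E" "S \<subseteq> V" "a \<in> S" "b \<in> V - S"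
  obtains i j where "i \<in> S" "j \<in> V - S" "E i j"
proof -
  have "S \<subset> V" "S \<noteq> {}" using assms by auto
  with assms(1) that show thesis unfolding cut_connected_def by blast
qed

text \<open>If \<open>S\<close> has no outgoing arc once \<open>m\<close> is removed, then in
  \<open>V\<close> every arc leaving \<open>S\<close> must end in \<open>m\<close>, and every arc
  leaving \<open>insert m S\<close> must start in \<open>m\<close>; both kinds exist because
  \<open>V\<close> is connected.\<close>

lemma not_cut_connected_delete:
  assumes "cut_connected V E" "m \<in> V" "\<not> cut_connected (V - {m}) E"
  obtains S x y where "S \<subseteq> V - {m}" "x \<in> S" "y \<in> V - {m} - S" "E x m" "E m y"
    "\<And>i j. i \<in> S \<Longrightarrow> j \<in> V - {m} - S \<Longrightarrow> \<not> E i j"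
proof -
  obtain S where S: "S \<subset> V - {m}" "S \<noteq> {}"
    and no: "\<And>i j. i \<in> S \<Longrightarrow> j \<in> V - {m} - S \<Longrightarrow> \<not> E i j"
    using assms(3) unfolding cut_connected_def by blast
  obtain a c where ac: "a \<in> S" "c \<in> V - {m} - S" using S by blast
  obtain x j where x: "x \<in> S" "j \<in> V - S" "E x j"
    using cut_connectedD[OF assms(1), of S a c] S ac by blast
  have "j = m" using no[of x j] x by blast
  obtain i y where y: "i \<in> insert m S" "y \<in> V - insert m S" "E i y"
    using cut_connectedD[OF assms(1), of "insert m S" a c] S ac assms(2) by blast
  have "i = m" using no[of i y] y by blast
  show thesis using that[of S x y] S x y no \<open>j = m\<close> \<open>i = m\<close> by blast
qed

text \<open>Needed because deleting a row and column renumbers the remaining indices.\<close>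

lemma cut_connected_preimage:
  assumes "bij_betw f U V" "cut_connected V E"
  shows "cut_connected U (\<lambda>i j. E (f i) (f j))"
  unfolding cut_connected_def
proof (intro allI impI)
  fix S assume S: "S \<subset> U" "S \<noteq> {}"
  then obtain a c where ac: "a \<in> S" "c \<in> U - S" by blast
  have inj: "inj_on f U" and V: "V = f ` U" using assms(1) by (auto simp: bij_betw_def)
  have "f c \<notin> f ` S" using inj_on_image_mem_iff[OF inj, of c S] ac S by blast
  then obtain i j where "i \<in> f ` S" "j \<in> V - f ` S" "E i j"
    using cut_connectedD[OF assms(2), of "f ` S" "f a" "f c"] S ac V by blast
  then show "\<exists>i\<in>S. \<exists>j\<in>U - S. E (f i) (f j)" unfolding V by blast
qed

section \<open>Deleting a vertex outside a three-element block\<close>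

locale comparison_digraph =
  fixes P K :: "'a set" and w :: "'a \<Rightarrow> real" and E :: "'a \<Rightarrow> 'a \<Rightarrow> bool"
  assumes card_P: "card P = 3"
    and disjoint: "P \<inter> K = {}"
    and comparison: "\<And>i j. i \<in> P \<union> K \<Longrightarrow> j \<in> P \<union> K \<Longrightarrow> i \<notin> P \<or> j \<notin> P \<Longrightarrow> E i j \<longleftrightarrow> w j \<le> w i"
    and semicomplete: "\<And>i j. i \<in> P \<Longrightarrow> j \<in> P \<Longrightarrow> E i j \<or> E j i"
    and connected: "cut_connected (P \<union> K) E"
begin

lemma P_cases:
  assumes "x \<in> P" "y \<in> P" "x \<noteq> y"
  obtains z where "P = {x, y, z}"
proof -
  have "finite P" using card_P card.infinite by fastforce
  then have "card (P - {x, y}) = 1" using assms card_P by (simp add: card_Diff_subset)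
  then obtain z where "P - {x, y} = {z}" by (auto simp: card_1_singleton_iff)
  then show thesis using assms that[of z] by blast
qed

text \<open>Without an arc from \<open>S\<close> to its complement, \<open>w\<close> increases
  strictly across the cut wherever arcs are comparisons. Since
  \<open>w y \<le> w m \<le> w x\<close>, the pair \<open>x\<close>, \<open>y\<close> violates this,
  so both lie in \<open>P\<close>. Only one vertex of \<open>P\<close> then remains to be
  controlled.\<close>

lemma bad_deletion:
  assumes "m \<in> K" "\<not> cut_connected (P \<union> K - {m}) E"
  obtains S x y where "S \<subseteq> P \<union> K - {m}" "x \<in> S" "y \<in> P \<union> K - {m} - S" "x \<in> P" "y \<in> P"
    "w m \<le> w x" "w y \<le> w m"
    "\<And>i j. i \<in> S \<Longrightarrow> j \<in> P \<union> K - {m} - S \<Longrightarrow> \<not> E i j"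
    "\<And>i j. i \<in> S \<Longrightarrow> j \<in> P \<union> K - {m} - S \<Longrightarrow> i \<notin> P \<or> j \<notin> P \<Longrightarrow> w i < w j"
proof -
  have m: "m \<in> P \<union> K" "m \<notin> P" using assms(1) disjoint by auto
  obtain S x y where S: "S \<subseteq> P \<union> K - {m}" "x \<in> S" "y \<in> P \<union> K - {m} - S" "E x m" "E m y"
    and no: "\<And>i j. i \<in> S \<Longrightarrow> j \<in> P \<union> K - {m} - S \<Longrightarrow> \<not> E i j"
    using not_cut_connected_delete[OF connected m(1) assms(2)] by metis
  have le: "w m \<le> w x" "w y \<le> w m"
    using comparison[of x m] comparison[of m y] S m by auto
  have lt: "w i < w j" if "i \<in> S" "j \<in> P \<union> K - {m} - S" "i \<notin> P \<or> j \<notin> P" for i j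
    using no[of i j] comparison[of i j] that S(1) by fastforce
  have "x \<in> P" "y \<in> P" using lt[of x y] le S by force+
  then show thesis using that[OF S(1-3) _ _ le no lt] by blast
qed

lemma delete_middle:
  assumes K: "t \<in> K" "b \<in> K" "m \<in> K - {t, b}"
    and t: "\<And>k. k \<in> K \<Longrightarrow> w k \<le> w t" and b: "\<And>k. k \<in> K \<Longrightarrow> w b \<le> w k"
  shows "cut_connected (P \<union> K - {m}) E"
proof (rule ccontr)
  assume bad: "\<not> ?thesis"
  have "m \<in> K" using K(3) by simp
  obtain S x y where S: "S \<subseteq> P \<union> K - {m}" "x \<in> S" "y \<in> P \<union> K - {m} - S" "x \<in> P" "y \<in> P"
    and le: "w m \<le> w x" "w y \<le> w m"
    and "\<And>i j. i \<in> S \<Longrightarrow> j \<in> P \<union> K - {m} - S \<Longrightarrow> \<not> E i j"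
    and lt: "\<And>i j. i \<in> S \<Longrightarrow> j \<in> P \<union> K - {m} - S \<Longrightarrow> i \<notin> P \<or> j \<notin> P \<Longrightarrow> w i < w j"
    by (fact bad_deletion[OF \<open>m \<in> K\<close> bad])
  have m: "w b \<le> w m" "w m \<le> w t" using t b K by auto
  have notP: "t \<notin> P" "b \<notin> P" using K disjoint by auto
  \<comment> \<open>Otherwise \<open>w x < w b \<le> w m \<le> w x\<close>; dually for
    \<open>t\<close>. Hence \<open>w b < w y \<le> w m \<le> w x < w t\<close>.\<close>
  have bS: "b \<in> S" using lt[of x b] le m notP K S by fastforce
  have tT: "t \<in> P \<union> K - {m} - S" using lt[of t y] le m notP K S by fastforce
  have xt: "w x < w t" and by': "w b < w y" and bt: "w b < w t"
    using lt[of x t] lt[of b y] lt[of b t] bS tT S notP by auto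
  obtain z where P: "P = {x, y, z}" using P_cases[of x y] S by blast
  \<comment> \<open>Depending on the third vertex \<open>z\<close>, all of \<open>P\<close> lies
    strictly below \<open>w t\<close> or strictly above \<open>w b\<close>. The level set cut off
    there then has only comparison arcs across its boundary, and these run downwards, so no arc
    leaves it.\<close>
  consider "w z < w t" | "w b < w z" using bt by linarith
  then show False
  proof cases
    case 1
    let ?U = "{v \<in> P \<union> K. w v < w t}"
    obtain i j where "i \<in> ?U" "j \<in> P \<union> K - ?U" "E i j"
      using cut_connectedD[OF connected, of ?U x t] xt S K by auto
    moreover then have "j \<notin> P" using P 1 xt le m by auto
    ultimately show False using comparison[of i j] by auto
  next
    case 2
    let ?U = "{v \<in> P \<union> K. w v \<le> w b}"
    obtain i j where "i \<in> ?U" "j \<in> P \<union> K - ?U" "E i j"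
      using cut_connectedD[OF connected, of ?U b y] by' S K by auto
    moreover then have "i \<notin> P" using P 2 by' le m by auto
    ultimately show False using comparison[of i j] by auto
  qed
qed

text \<open>If both deletions fail, each supplies a cut of its own. The inequalities force
  \<open>x' = y\<close> and make \<open>y'\<close> the third vertex of \<open>P\<close>. The first
  cut forbids the arc from \<open>y'\<close> to \<open>y\<close>, the second the reverse arc,
  contrary to semicompleteness.\<close>

lemma delete_one_of_two:
  assumes K: "K = {t, b}" "t \<noteq> b" and tb: "w b \<le> w t"
  shows "cut_connected (P \<union> K - {t}) E \<or> cut_connected (P \<union> K - {b}) E"
proof (rule ccontr)
  assume "\<not> ?thesis"
  then have bad: "\<not> cut_connected (P \<union> K - {t}) E" "\<not> cut_connected (P \<union> K - {b}) E" by auto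
  have "t \<in> K" "b \<in> K" using K by auto
  obtain S x y where S: "S \<subseteq> P \<union> K - {t}" "x \<in> S" "y \<in> P \<union> K - {t} - S" "x \<in> P" "y \<in> P"
    and le: "w t \<le> w x" "w y \<le> w t"
    and no: "\<And>i j. i \<in> S \<Longrightarrow> j \<in> P \<union> K - {t} - S \<Longrightarrow> \<not> E i j"
    and lt: "\<And>i j. i \<in> S \<Longrightarrow> j \<in> P \<union> K - {t} - S \<Longrightarrow> i \<notin> P \<or> j \<notin> P \<Longrightarrow> w i < w j"
    by (fact bad_deletion[OF \<open>t \<in> K\<close> bad(1)])
  obtain S' x' y' where S': "S' \<subseteq> P \<union> K - {b}" "x' \<in> S'" "y' \<in> P \<union> K - {b} - S'" "x' \<in> P" "y' \<in> P"
    and le': "w b \<le> w x'" "w y' \<le> w b"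
    and no': "\<And>i j. i \<in> S' \<Longrightarrow> j \<in> P \<union> K - {b} - S' \<Longrightarrow> \<not> E i j"
    and lt': "\<And>i j. i \<in> S' \<Longrightarrow> j \<in> P \<union> K - {b} - S' \<Longrightarrow> i \<notin> P \<or> j \<notin> P \<Longrightarrow> w i < w j"
    by (fact bad_deletion[OF \<open>b \<in> K\<close> bad(2)])
  have notP: "t \<notin> P" "b \<notin> P" using K disjoint by auto
  have bS: "b \<in> S" using lt[of x b] le tb notP K S by fastforce
  have tT: "t \<in> P \<union> K - {b} - S'" using lt'[of t y'] le' tb notP K S' by fastforce
  have by': "w b < w y" and xt: "w x' < w t"
    using lt[of b y] lt'[of x' t] bS tT S S' notP by auto
  have "y' \<noteq> x" "y' \<noteq> y" using by' le le' by auto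
  moreover have "x \<noteq> y" using S by auto
  ultimately have "P = {x, y, y'}" using P_cases[of x y] S S'(5)
    by (metis insertE singletonD)
  moreover have "x' \<noteq> x" "x' \<noteq> y'" using le xt S' by auto
  ultimately have "x' = y" using S' by blast
  \<comment> \<open>Otherwise \<open>b\<close> and \<open>y'\<close> are separated by the first cut,
    giving \<open>w b < w y' \<le> w b\<close>.\<close>
  have "y' \<in> S" using lt[of b y'] bS le' S' notP K by fastforce
  then show False
    using no[of y' y] no'[of x' y'] \<open>x' = y\<close> S S' semicomplete[of y y'] by blast
qed

lemma delete_comparison_vertex:
  assumes "card K \<ge> 2"
  shows "\<exists>m\<in>K. cut_connected (P \<union> K - {m}) E"
proof -
  have fin: "finite K" and ne: "K \<noteq> {}" using assms card.infinite by fastforce+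
  obtain t where t: "t \<in> K" "\<And>k. k \<in> K \<Longrightarrow> w k \<le> w t"
    using fin ne Max_in[of "w ` K"] Max_ge[of "w ` K"]
    by (metis (no_types, lifting) finite_imageI imageE image_eqI image_is_empty)
  obtain b where b: "b \<in> K" "\<And>k. k \<in> K \<Longrightarrow> w b \<le> w k"
    using fin ne Min_in[of "w ` K"] Min_le[of "w ` K"]
    by (metis (no_types, lifting) finite_imageI imageE image_eqI image_is_empty)
  show ?thesis
  proof (cases "K \<subseteq> {t, b}")
    case True
    then have K: "K = {t, b}" using t b by blast
    then have "t \<noteq> b" using assms by auto
    then show ?thesis using delete_one_of_two[OF K] t b K by blast
  next
    case False
    then obtain m where "m \<in> K - {t, b}" by blast
    then show ?thesis using delete_middle[of t b m] t b by blast
  qed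
qed

end

section \<open>Efficiency as strong connectivity of the digraph\<close>

lemma reciprocal_mat_less_swap:
  assumes "reciprocal_mat A" "i < dim_row A" "j < dim_row A" "x / y < A $$ (i, j)" "0 < x" "0 < y"
  shows "A $$ (j, i) < y / x"
proof -
  have "A $$ (j, i) = 1 / A $$ (i, j)" "0 < A $$ (i, j)"
    using assms unfolding reciprocal_mat_def by blast+
  then show ?thesis using assms by (simp add: divide_less_eq less_divide_eq mult.commute)
qed

lemma efficient_imp_cut_connected:
  assumes A: "reciprocal_mat A" and "efficient A w"
  shows "cut_connected {..<dim_row A} (\<lambda>i j. A $$ (i, j) \<le> w $ i / w $ j)"
proof (rule ccontr)
  let ?n = "dim_row A"
  assume "\<not> ?thesis"
  then have "\<exists>S\<subset>{..<?n}. S \<noteq> {} \<and> (\<forall>i\<in>S. \<forall>j\<in>{..<?n} - S. w $ i / w $ j < A $$ (i, j))"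
    by (simp add: cut_connected_def not_le)
  then obtain S where S: "S \<subset> {..<?n}" "S \<noteq> {}"
    and less: "\<And>i j. i \<in> S \<Longrightarrow> j \<in> {..<?n} - S \<Longrightarrow> w $ i / w $ j < A $$ (i, j)"
    by blast
  let ?T = "{..<?n} - S"
  have dim: "dim_vec w = ?n" and pos: "\<And>i. i < ?n \<Longrightarrow> 0 < w $ i"
    and eff: "\<And>v. v \<in> carrier_vec ?n \<Longrightarrow> positive_vec v \<Longrightarrow>
        (\<forall>i < ?n. \<forall>j < ?n.
           \<bar>A $$ (i, j) - v $ i / v $ j\<bar> \<le> \<bar>A $$ (i, j) - w $ i / w $ j\<bar>) \<Longrightarrow>
        \<exists>c > 0. v = c \<cdot>\<^sub>v w"
    using assms(2) unfolding efficient_def positive_vec_def by auto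
  \<comment> \<open>The minimum \<open>r\<close> is the largest factor by which \<open>w\<close> can
    grow on \<open>S\<close> before some ratio from \<open>S\<close> to its complement overshoots
    its matrix entry. It exceeds 1 because the missing arcs are strict inequalities.\<close>
  define R where "R = (\<lambda>(i, j). A $$ (i, j) * w $ j / w $ i) ` (S \<times> ?T)"
  define r where "r = Min R"
  have finR: "finite R" unfolding R_def using S finite_subset[of S "{..<?n}"] by auto
  have neR: "R \<noteq> {}" unfolding R_def using S by auto
  have "x > 1" if "x \<in> R" for x
    using that less pos S unfolding R_def by (fastforce simp: field_simps)
  then have r1: "r > 1" unfolding r_def using finR neR by simp
  have rle: "r * (w $ i / w $ j) \<le> A $$ (i, j)" if "i \<in> S" "j \<in> ?T" for i j
  proof -
    have "r \<le> A $$ (i, j) * w $ j / w $ i"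
      unfolding r_def using finR that by (intro Min_le) (force simp: R_def)+
    moreover have "0 < w $ i" "0 < w $ j" using that S pos by auto
    ultimately show ?thesis by (simp add: field_simps)
  qed
  define v where "v = vec ?n (\<lambda>i. if i \<in> S then r * w $ i else w $ i)"
  have v: "v $ i = (if i \<in> S then r * w $ i else w $ i)" if "i < ?n" for i
    using that by (simp add: v_def)
  have vpos: "positive_vec v"
    unfolding positive_vec_def using pos r1 by (auto simp: v_def)
  have "\<bar>A $$ (i, j) - v $ i / v $ j\<bar> \<le> \<bar>A $$ (i, j) - w $ i / w $ j\<bar>"
    if ij: "i < ?n" "j < ?n" for i j
  proof -
    have p: "0 < w $ i" "0 < w $ j" using pos ij by auto
    consider "i \<in> S \<longleftrightarrow> j \<in> S" | "i \<in> S" "j \<in> ?T" | "i \<in> ?T" "j \<in> S" using ij by blast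
    then show ?thesis
    proof cases
      case 1
      then show ?thesis using v ij r1 by auto
    next
      case 2
      have "v $ i / v $ j = r * (w $ i / w $ j)" using v ij 2 by auto
      moreover have "w $ i / w $ j \<le> r * (w $ i / w $ j)" using r1 p by (simp add: divide_right_mono)
      ultimately show ?thesis using rle[OF 2] by linarith
    next
      case 3
      have eq: "v $ i / v $ j = w $ i / w $ j / r" using v ij 3 by auto
      have "w $ i / w $ j / r \<le> w $ i / w $ j" using r1 p by (simp add: field_simps)
      \<comment> \<open>Reciprocity turns the bound for the pair \<open>(j, i)\<close> into this
        one: the ratio shrinks without passing its entry.\<close>
      moreover have "A $$ (i, j) \<le> w $ i / w $ j / r"
      proof -
        have a: "A $$ (i, j) = 1 / A $$ (j, i)" "0 < A $$ (j, i)"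
          using A ij unfolding reciprocal_mat_def by blast+
        show ?thesis unfolding a(1) using rle[OF 3(2,1)] p a(2) r1 by (simp add: field_simps)
      qed
      ultimately show ?thesis using eq by linarith
    qed
  qed
  then obtain c where c: "v = c \<cdot>\<^sub>v w" using eff[of v] vpos by (auto simp: v_def)
  obtain a d where ad: "a \<in> S" "d \<in> ?T" using S by blast
  then have lt: "a < ?n" "d < ?n" using S by auto
  \<comment> \<open>An index inside \<open>S\<close> forces the factor \<open>r\<close>, one outside
    forces 1.\<close>
  have "v $ a = c * w $ a" "v $ d = c * w $ d" using c lt dim by auto
  then have "r = c" "c = 1" using v[OF lt(1)] v[OF lt(2)] ad pos[OF lt(1)] pos[OF lt(2)] by auto
  then show False using r1 by simp
qed

lemma cut_connected_imp_efficient: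
  assumes w: "w \<in> carrier_vec (dim_row A)" "positive_vec w"
    and con: "cut_connected {..<dim_row A} (\<lambda>i j. A $$ (i, j) \<le> w $ i / w $ j)"
  shows "efficient A w"
  unfolding efficient_def
proof (intro conjI ballI impI w)
  let ?n = "dim_row A"
  fix v assume v: "v \<in> carrier_vec ?n" "positive_vec v"
    and le: "\<forall>i < ?n. \<forall>j < ?n.
      \<bar>A $$ (i, j) - v $ i / v $ j\<bar> \<le> \<bar>A $$ (i, j) - w $ i / w $ j\<bar>"
  have pos: "0 < w $ i" "0 < v $ i" if "i < ?n" for i
    using w v that unfolding positive_vec_def by auto
  show "\<exists>c > 0. v = c \<cdot>\<^sub>v w"
  \<comment> \<open>The maximum taken below needs a nonempty index set.\<close>
  proof (cases "?n = 0")
    case True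
    then show ?thesis using v w by (intro exI[of _ 1]) auto
  next
    case False
    define R where "R = (\<lambda>i. v $ i / w $ i) ` {..<?n}"
    define c where "c = Max R"
    have "c \<in> R" unfolding c_def by (rule Max_in) (use False in \<open>auto simp: R_def\<close>)
    then obtain a where a: "a < ?n" "c = v $ a / w $ a" unfolding R_def by auto
    have cge: "v $ i / w $ i \<le> c" if "i < ?n" for i
      unfolding c_def by (rule Max_ge) (use that in \<open>auto simp: R_def\<close>)
    let ?S = "{i \<in> {..<?n}. v $ i / w $ i = c}"
    have all: "v $ d / w $ d = c" if d: "d < ?n" for d
    proof (rule ccontr)
      assume "v $ d / w $ d \<noteq> c"
      then obtain i j where i: "i \<in> ?S" and j: "j \<in> {..<?n} - ?S" and E: "A $$ (i, j) \<le> w $ i / w $ j"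
        using cut_connectedD[OF con, of ?S a d] a d by auto
      have ij: "i < ?n" "j < ?n" using i j by auto
      have "v $ j / w $ j < v $ i / w $ i" using i j cge[of j] by force
      then have "w $ i / w $ j < v $ i / v $ j"
        using pos[OF ij(1)] pos[OF ij(2)] by (simp add: field_simps)
      moreover have "\<bar>A $$ (i, j) - v $ i / v $ j\<bar> \<le> \<bar>A $$ (i, j) - w $ i / w $ j\<bar>"
        using le ij by blast
      ultimately show False using E by linarith
    qed
    have "0 < c" using a pos by auto
    moreover have "v = c \<cdot>\<^sub>v w"
    proof (rule eq_vecI)
      fix i assume "i < dim_vec (c \<cdot>\<^sub>v w)"
      then have "i < ?n" using w by auto
      then show "v $ i = (c \<cdot>\<^sub>v w) $ i" using all[of i] pos[of i] w by (auto simp: field_simps)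
    qed (use v w in auto)
    ultimately show ?thesis by blast
  qed
qed

section \<open>Passing to a principal submatrix\<close>

lemma bij_betw_insert_index:
  assumes "i < n"
  shows "bij_betw (insert_index i) {..<n - 1} ({..<n} - {i})"
proof -
  have "insert_index i ` {..<n - 1} = {..<n} - {i}"
    using insert_index_image[of i "n - 1"] assms by (simp add: lessThan_atLeast0)
  then show ?thesis
    using insert_index_inj_on[of i "{..<n - 1}"] by (simp add: bij_betw_def)
qed

text \<open>The digraph of the principal submatrix is the induced subdigraph on the other indices,
  relabelled by \<open>insert_index m\<close>.\<close>

lemma efficient_delete:
  assumes A: "A \<in> carrier_mat n n" and w: "w \<in> carrier_vec n" "positive_vec w" and m: "m < n"
    and con: "cut_connected ({..<n} - {m}) (\<lambda>i j. A $$ (i, j) \<le> w $ i / w $ j)"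
  shows "efficient (mat_delete A m m) (vec_delete w m)"
proof (rule cut_connected_imp_efficient)
  have dimA: "dim_row (mat_delete A m m) = n - 1" using A by (simp add: mat_delete_def)
  have ins: "insert_index m i < n" if "i < n - 1" for i
    using that by (auto simp: insert_index_def)
  have vd: "vec_delete w m $ i = w $ insert_index m i" if "i < n - 1" for i
    using that w by (simp add: vec_delete_def insert_index_def)
  show "vec_delete w m \<in> carrier_vec (dim_row (mat_delete A m m))"
    using w dimA by (simp add: vec_delete_def)
  show "positive_vec (vec_delete w m)"
    unfolding positive_vec_def using w vd ins by (auto simp: vec_delete_def positive_vec_def)
  have md: "mat_delete A m m $$ (i, j) = A $$ (insert_index m i, insert_index m j)"
    if "i < n - 1" "j < n - 1" for i j
    using mat_delete_index[of A "n - 1" m m i j] A m that by simp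
  show "cut_connected {..<dim_row (mat_delete A m m)}
      (\<lambda>i j. mat_delete A m m $$ (i, j) \<le> vec_delete w m $ i / vec_delete w m $ j)"
    unfolding dimA cut_connected_def
  proof (intro allI impI)
    fix S assume S: "S \<subset> {..<n - 1}" "S \<noteq> {}"
    obtain i j where "i \<in> S" "j \<in> {..<n - 1} - S"
      "A $$ (insert_index m i, insert_index m j) \<le> w $ insert_index m i / w $ insert_index m j"
      using cut_connected_preimage[OF bij_betw_insert_index[OF m] con] S
      unfolding cut_connected_def by blast
    moreover then have "i < n - 1" "j < n - 1" using S by auto
    ultimately show "\<exists>i\<in>S. \<exists>j\<in>{..<n - 1} - S.
        mat_delete A m m $$ (i, j) \<le> vec_delete w m $ i / vec_delete w m $ j"
      using vd md by (metis (no_types, lifting))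
  qed
qed

theorem theorem16:
  fixes n :: nat and A B :: "real mat"
  assumes "5 \<le> n"
    and "B \<in> carrier_mat 3 3"
    and "reciprocal_mat B"
    and "A = four_block_mat B (ones_mat 3 (n - 3)) (ones_mat (n - 3) 3) (ones_mat (n - 3) (n - 3))"
  shows "efficient_vecs A = (\<Union>i\<in>{3..<n}. efficient_vecs_at A i)"
proof
  \<comment> \<open>Indices start at 0, so \<open>{3..<n}\<close> stands for the positions 4 to
    n.\<close>
  show "(\<Union>i\<in>{3..<n}. efficient_vecs_at A i) \<subseteq> efficient_vecs A"
    unfolding efficient_vecs_at_def by blast
  have A: "A \<in> carrier_mat n n" using assms(1,2) unfolding assms(4) by (auto simp: ones_mat_def)
  have one: "A $$ (i, j) = 1" if "i < n" "j < n" "3 \<le> i \<or> 3 \<le> j" for i j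
    using that assms(1,2) unfolding assms(4) by (auto simp: ones_mat_def)
  have block: "A $$ (i, j) = B $$ (i, j)" if "i < 3" "j < 3" for i j
    using that assms(1,2) unfolding assms(4) by (auto simp: ones_mat_def)
  have B: "0 < B $$ (i, j) \<and> B $$ (j, i) = 1 / B $$ (i, j)" if "i < 3" "j < 3" for i j
    using that assms(3) carrier_matD(1)[OF assms(2)] unfolding reciprocal_mat_def by metis
  have rec: "0 < A $$ (i, j) \<and> A $$ (j, i) = 1 / A $$ (i, j)" if "i < n" "j < n" for i j
  proof (cases "i < 3 \<and> j < 3")
    case True
    then show ?thesis using B[of i j] block[of i j] block[of j i] by metis
  next
    case False
    then show ?thesis using that one[of i j] one[of j i] by auto
  qed
  have recA: "reciprocal_mat A"
    using rec carrier_matD[OF A] unfolding reciprocal_mat_def square_mat.simps by metis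
  show "efficient_vecs A \<subseteq> (\<Union>i\<in>{3..<n}. efficient_vecs_at A i)"
  proof
    fix w assume "w \<in> efficient_vecs A"
    then have eff: "efficient A w" by (simp add: efficient_vecs_def)
    then have w: "w \<in> carrier_vec n" "positive_vec w" using A by (auto simp: efficient_def)
    then have pos: "0 < w $ i" if "i < n" for i using that by (auto simp: positive_vec_def)
    let ?E = "\<lambda>i j. A $$ (i, j) \<le> w $ i / w $ j"
    have V: "{..<3} \<union> {3..<n} = {..<n}" using assms(1) by auto
    \<comment> \<open>Entries outside \<open>B\<close> are 1, so arcs there compare entries of
      \<open>w\<close>; inside \<open>B\<close>, reciprocity turns a missing arc into a strict
      inequality for the reverse one.\<close>
    interpret comparison_digraph "{..<3}" "{3..<n}" "\<lambda>i. w $ i" ?E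
    proof
      show "cut_connected ({..<3} \<union> {3..<n}) ?E"
        using efficient_imp_cut_connected[OF recA eff] A V by simp
      show "?E i j \<longleftrightarrow> w $ j \<le> w $ i"
        if "i \<in> {..<3} \<union> {3..<n}" "j \<in> {..<3} \<union> {3..<n}" "i \<notin> {..<3} \<or> j \<notin> {..<3}" for i j
        using that one[of i j] pos[of i] pos[of j] unfolding V by (auto simp: field_simps)
      show "?E i j \<or> ?E j i" if "i \<in> {..<3}" "j \<in> {..<3}" for i j
        using that reciprocal_mat_less_swap[OF recA, of i j "w $ i" "w $ j"] pos[of i] pos[of j] A assms(1)
        by force
    qed auto
    \<comment> \<open>Here \<open>5 \<le> n\<close> supplies two candidates for deletion.\<close>
    have "2 \<le> card {3..<n}" using assms(1) by simp
    then obtain m where "m \<in> {3..<n}" "cut_connected ({..<n} - {m}) ?E"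
      using delete_comparison_vertex unfolding V by blast
    moreover then have "efficient (mat_delete A m m) (vec_delete w m)"
      using efficient_delete[OF A w] by simp
    ultimately show "w \<in> (\<Union>i\<in>{3..<n}. efficient_vecs_at A i)"
      using eff unfolding efficient_vecs_at_def efficient_vecs_def by blast
  qed
qed

end
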